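(* Suppose the support $\mathcal X\subseteq\mathbb R^p$ of $X$ is compact with $\max_{x\in\mathcal X}\|x\|_\infty=\bar X$, and $\psi_j:\mathbb R^d\to\mathbb R$ is $L_\psi$-Lipschitz continuous for every $j\in[J]$. Then with probability at least $1-\delta$ over the draw of the i.i.d. sample $\Xi=\{(x^s,y^s)\}_{s=1}^n$, $$\begin{aligned}\mathbb P_X\Big[\max_{j\in[J]}\psi_j\big(f^*_{\Xi,\widetilde{\mathcal H}^K_{\mu,\gamma}}(X)\big)>0\Big]<{}&\sqrt{\frac{4dK(p+1)}{n}\log\Big(\Big\lceil\frac{8L_\psi}{\gamma}\sqrt{2K(p\bar X^2+1)}\cdot d(p+1)\mu\Big\rceil\Big)}\\&+\sqrt{\frac{\log(2n)}{n}}+\sqrt{\frac{2\log(1/\delta)}{n}}.\end{aligned}$$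
   Context: $X$ (with support $\mathcal X\subseteq\mathbb R^p$) is a random feature vector, $Y$ (with support $\mathcal Y$) a random variable, $\varphi:\mathbb R^d\times\mathcal Y\to\mathbb R$ a cost function, $\Xi=\{(x^s,y^s)\}_{s=1}^n$ a sample of $(X,Y)$; $\|\cdot\|$ is the Euclidean norm. $\mathcal H_\mu^K$ is the class of all $f=(f_\iota(\cdot,\theta_\iota))_{\iota=1}^d:\mathcal X\to\mathbb R^d$ with $f_\iota(x,\theta_\iota)=\max_{k\in[K]}\{(\alpha_\iota^k)^\top x+a_\iota^k\}-\max_{k\in[K]}\{(\beta_\iota^k)^\top x+b_\iota^k\}$, $\theta_\iota=(\alpha_\iota^k,a_\iota^k,\beta_\iota^k,b_\iota^k)_{k=1}^K\in\mathbb R^{2K(p+1)}$, $\|\theta_\iota\|_\infty\le\mu$ for $\iota\in[d]$. For $\gamma>0$, $\widetilde{\mathcal H}^K_{\mu,\gamma}=\{f\in\mathcal H_\mu^K:\psi_j(f(x^s))+\gamma\le0,\ s\in[n],\ j\in[J]\}$, and $f^*_{\Xi,\widetilde{\mathcal H}^K_{\mu,\gamma}}$ is an optimal solution of $\min\{\frac1n\sum_{s=1}^n\varphi(f(x^s),y^s): f\in\widetilde{\mathcal H}^K_{\mu,\gamma}\}$. *)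

theory Defs
  imports "HOL-Probability.Probability"
begin

text \<open>Topological support of a Borel measure: the points all of whose open neighbourhoods
  have positive mass.\<close>

definition measure_support :: "'a::topological_space measure \<Rightarrow> 'a set" where
  "measure_support D = {x. \<forall>U. open U \<longrightarrow> x \<in> U \<longrightarrow> emeasure D U > 0}"

text \<open>A parameter of one component is a family \<open>t k = (\<alpha>\<^sup>k, a\<^sup>k, \<beta>\<^sup>k, b\<^sup>k)\<close>, of which only
  \<open>k \<in> {1..K}\<close> matters. Since \<^const>\<open>infnorm\<close> of a nested pair is the largest absolute value
  among all its real coordinates, \<open>params_infnorm K t\<close> is the sup-norm of \<open>t\<close> viewed as a
  vector with \<open>2 * K * (p + 1)\<close> real coordinates.\<close>

type_synonym 'p pa_params = "nat \<Rightarrow> (real ^ 'p) \<times> real \<times> (real ^ 'p) \<times> real"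

definition params_infnorm :: "nat \<Rightarrow> 'p::finite pa_params \<Rightarrow> real" where
  "params_infnorm K t = (MAX k\<in>{1..K}. infnorm (t k))"

definition pa_fun :: "nat \<Rightarrow> 'p::finite pa_params \<Rightarrow> real ^ 'p \<Rightarrow> real" where
  "pa_fun K t x =
     (MAX k\<in>{1..K}. case t k of (\<alpha>, a, \<beta>, b) \<Rightarrow> \<alpha> \<bullet> x + a) -
     (MAX k\<in>{1..K}. case t k of (\<alpha>, a, \<beta>, b) \<Rightarrow> \<beta> \<bullet> x + b)"

definition pa_class :: "nat \<Rightarrow> real \<Rightarrow> (real ^ 'p \<Rightarrow> real ^ 'd) set" where
  "pa_class K \<mu> =
     {f. \<exists>\<theta> :: 'd \<Rightarrow> 'p pa_params.
           (\<forall>\<iota>. params_infnorm K (\<theta> \<iota>) \<le> \<mu>) \<and> f = (\<lambda>x. \<chi> \<iota>. pa_fun K (\<theta> \<iota>) x)}"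

text \<open>A sample of size \<open>n\<close> is a family of pairs \<open>\<Xi> s = (x\<^sup>s, y\<^sup>s)\<close>, \<open>s \<in> {1..n}\<close>.\<close>

definition feasible_class ::
  "nat \<Rightarrow> real \<Rightarrow> real \<Rightarrow> nat \<Rightarrow> (nat \<Rightarrow> real ^ 'd \<Rightarrow> real) \<Rightarrow> nat \<Rightarrow>
   (nat \<Rightarrow> (real ^ 'p) \<times> 'y) \<Rightarrow> (real ^ 'p \<Rightarrow> real ^ 'd) set" where
  "feasible_class K \<mu> \<gamma> J \<psi> n \<Xi> =
     {f \<in> pa_class K \<mu>. \<forall>s\<in>{1..n}. \<forall>j\<in>{1..J}. \<psi> j (f (fst (\<Xi> s))) + \<gamma> \<le> 0}"

definition empirical_cost ::
  "(real ^ 'd \<Rightarrow> 'y \<Rightarrow> real) \<Rightarrow> nat \<Rightarrow> (nat \<Rightarrow> (real ^ 'p) \<times> 'y) \<Rightarrow>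
   (real ^ 'p \<Rightarrow> real ^ 'd) \<Rightarrow> real" where
  "empirical_cost \<phi> n \<Xi> f = (1 / real n) * (\<Sum>s=1..n. \<phi> (f (fst (\<Xi> s))) (snd (\<Xi> s)))"

definition optimal_solution ::
  "(real ^ 'd \<Rightarrow> 'y \<Rightarrow> real) \<Rightarrow> nat \<Rightarrow> (nat \<Rightarrow> (real ^ 'p) \<times> 'y) \<Rightarrow>
   (real ^ 'p \<Rightarrow> real ^ 'd) set \<Rightarrow> (real ^ 'p \<Rightarrow> real ^ 'd) \<Rightarrow> bool" where
  "optimal_solution \<phi> n \<Xi> F f \<longleftrightarrow> is_arg_min (empirical_cost \<phi> n \<Xi>) (\<lambda>g. g \<in> F) f"

text \<open>Law of \<open>n\<close> i.i.d. copies of \<open>(X, Y)\<close>.\<close>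

definition iid_sample ::
  "nat \<Rightarrow> 'w measure \<Rightarrow> 'y measure \<Rightarrow> ('w \<Rightarrow> real ^ 'p) \<Rightarrow> ('w \<Rightarrow> 'y) \<Rightarrow>
   (nat \<Rightarrow> (real ^ 'p) \<times> 'y) measure" where
  "iid_sample n M N X Y =
     (\<Pi>\<^sub>M s\<in>{1..n}. distr M (borel \<Otimes>\<^sub>M N) (\<lambda>\<omega>. (X \<omega>, Y \<omega>)))"

end

theory Submission
  imports Defs
begin

text \<open>
  The function class is parametrised by the vectors of a sup-norm ball of radius \<open>\<mu>\<close>, and on
  the support of \<open>X\<close> a map depends on its parameters in a Lipschitz way. So a grid with \<open>m\<close>
  points per coordinate gives a finite set of maps, at most \<open>m ^ (2 * (p + 1) * K * d)\<close> of them,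
  such that every map \<open>f\<close> of the class is close to some grid map \<open>g\<close> uniformly on the support;
  the integer under the logarithm is large enough for \<open>\<psi>\<^sub>j \<circ> f\<close> and \<open>\<psi>\<^sub>j \<circ> g\<close> to differ by at
  most \<open>\<gamma> / 2\<close> (\<open>pa_map_cover\<close>, \<open>grid_fine_enough\<close>).

  Attach to each grid map \<open>g\<close> the set \<open>A\<^sub>g\<close> of the points \<open>x\<close> of the support with
  \<open>\<psi>\<^sub>j (g x) > - \<gamma> / 2\<close> for some \<open>j\<close>. Half of the margin \<open>\<gamma>\<close> is spent on each side: if \<open>f\<close> is
  feasible with margin \<open>\<gamma>\<close> on the sample then no sample point lies in \<open>A\<^sub>g\<close>, whereas every \<open>x\<close>
  of the support with \<open>\<psi>\<^sub>j (f x) > 0\<close> for some \<open>j\<close> lies in \<open>A\<^sub>g\<close>. A set of probability above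
  \<open>\<eta>\<close> is missed by \<open>n\<close> independent points with probability at most \<open>exp (- n * \<eta>)\<close>, so by the
  union bound, with probability at least \<open>1 - \<delta>\<close> all of the sets \<open>A\<^sub>g\<close> of probability above
  \<open>\<eta> = (ln (m ^ (2 * (p + 1) * K * d)) + ln (1 / \<delta>)) / n\<close> are hit at once
  (\<open>sample_hits_heavy_sets\<close>). On that event every feasible map, in particular an optimal one,
  violates the constraints with probability at most \<open>\<eta>\<close> (\<open>feasible_violation_bound\<close>).

  This rate is linear in \<open>1 / n\<close>. It implies the stated one because a probability is at most
  \<open>1\<close> and \<open>min 1 u \<le> sqrt u\<close>; the term \<open>sqrt (ln (2 * n) / n)\<close> makes the inequality strict.
\<close>

section \<open>Finite covers of sup-norm balls\<close>

text \<open>The centres of \<open>m\<close> adjacent intervals of length \<open>2 * \<mu> / m\<close> that fill \<open>[-\<mu>, \<mu>]\<close>. For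
  negative \<open>\<mu>\<close> there is nothing to cover.\<close>

lemma interval_cover:
  fixes \<mu> :: real and m :: nat
  assumes "m \<ge> 1"
  shows "\<exists>C. finite C \<and> card C \<le> m \<and> (\<forall>t. \<bar>t\<bar> \<le> \<mu> \<longrightarrow> (\<exists>c\<in>C. \<bar>t - c\<bar> \<le> \<mu> / m))"
proof -
  have tile: "\<exists>i<m. \<bar>t - (a + (2 * real i + 1) * h)\<bar> \<le> h"
    if "a \<le> t" "t \<le> a + 2 * m * h" for a t h :: real
    using assms that(2)
  proof (induction m rule: nat_induct_at_least)
    case base
    then show ?case using that(1) by (intro exI[of _ 0]) (auto simp: abs_le_iff)
  next
    case (Suc m)
    show ?case
    proof (cases "t \<le> a + 2 * m * h")
      case True
      then show ?thesis using Suc.IH less_Suc_eq by blast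
    next
      case False
      then show ?thesis using Suc.prems
        by (intro exI[of _ m]) (auto simp: abs_le_iff algebra_simps)
    qed
  qed
  define C where "C = (\<lambda>i. - \<mu> + (2 * real i + 1) * (\<mu> / m)) ` {..<m}"
  have "\<exists>c\<in>C. \<bar>t - c\<bar> \<le> \<mu> / m" if "\<bar>t\<bar> \<le> \<mu>" for t
  proof -
    have "- \<mu> \<le> t" "t \<le> - \<mu> + 2 * m * (\<mu> / m)" using that assms by auto
    then show ?thesis using tile unfolding C_def by blast
  qed
  moreover have "finite C" "card C \<le> m"
    unfolding C_def using card_image_le[of "{..<m}"] by auto
  ultimately show ?thesis by blast
qed

lemma infnorm_le_iff:
  fixes x :: "'a::euclidean_space"
  shows "infnorm x \<le> r \<longleftrightarrow> (\<forall>b\<in>Basis. \<bar>x \<bullet> b\<bar> \<le> r)"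
  by (auto simp: infnorm_Max)

lemma infnorm_ball_cover:
  fixes \<mu> :: real and m :: nat
  assumes "m \<ge> 1"
  shows "\<exists>C :: 'a::euclidean_space set. finite C \<and> card C \<le> m ^ DIM('a) \<and>
    (\<forall>x. infnorm x \<le> \<mu> \<longrightarrow> (\<exists>c\<in>C. infnorm (x - c) \<le> \<mu> / m))"
proof -
  obtain G where G: "finite G" "card G \<le> m"
    and cover: "\<And>t. \<bar>t\<bar> \<le> \<mu> \<Longrightarrow> \<exists>c\<in>G. \<bar>t - c\<bar> \<le> \<mu> / m"
    using interval_cover[OF assms] by blast
  define F where "F = (PiE (Basis :: 'a set) (\<lambda>_. G))"
  define v :: "('a \<Rightarrow> real) \<Rightarrow> 'a" where "v g = (\<Sum>b\<in>Basis. g b *\<^sub>R b)" for g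
  have "finite F" unfolding F_def by (intro finite_PiE) (use G in auto)
  have "card F \<le> m ^ DIM('a)"
    unfolding F_def by (simp add: card_PiE power_mono G)
  then have "card (v ` F) \<le> m ^ DIM('a)"
    using card_image_le[OF \<open>finite F\<close>] le_trans by blast
  moreover have "\<exists>c\<in>v ` F. infnorm (x - c) \<le> \<mu> / m" if "infnorm x \<le> \<mu>" for x :: 'a
  proof -
    have "\<forall>b\<in>Basis. \<exists>c\<in>G. \<bar>x \<bullet> b - c\<bar> \<le> \<mu> / m"
      using that cover by (simp add: infnorm_le_iff)
    then obtain g where g: "\<And>b. b \<in> Basis \<Longrightarrow> g b \<in> G \<and> \<bar>x \<bullet> b - g b\<bar> \<le> \<mu> / m"
      by metis
    have "restrict g Basis \<in> F" using g by (auto simp: F_def)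
    moreover have "v (restrict g Basis) \<bullet> b = g b" if "b \<in> Basis" for b
      using that by (simp add: v_def)
    then have "infnorm (x - v (restrict g Basis)) \<le> \<mu> / m"
      using g by (simp add: infnorm_le_iff inner_diff_left)
    ultimately show ?thesis by blast
  qed
  ultimately show ?thesis using \<open>finite F\<close> by (intro exI[of _ "v ` F"]) auto
qed

section \<open>Dependence of the maps on their parameters\<close>

definition pa_map :: "nat \<Rightarrow> ('d \<Rightarrow> 'p::finite pa_params) \<Rightarrow> real ^ 'p \<Rightarrow> real ^ 'd" where
  "pa_map K \<theta> x = (\<chi> \<iota>. pa_fun K (\<theta> \<iota>) x)"

lemma params_infnorm_nonneg:
  assumes "K \<ge> 1"
  shows "0 \<le> params_infnorm K t"
proof -
  have "0 \<le> infnorm (t 1)" by (rule infnorm_pos_le)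
  also have "\<dots> \<le> params_infnorm K t"
    unfolding params_infnorm_def using assms by (intro Max_ge) auto
  finally show ?thesis .
qed

lemma l1_Pair:
  fixes x :: "'a::euclidean_space" and y :: "'b::euclidean_space"
  shows "(\<Sum>b\<in>Basis. \<bar>(x, y) \<bullet> b\<bar>) = (\<Sum>b\<in>Basis. \<bar>x \<bullet> b\<bar>) + (\<Sum>b\<in>Basis. \<bar>y \<bullet> b\<bar>)"
proof -
  have "inj_on (\<lambda>u::'a. (u, 0::'b)) Basis" "inj_on (\<lambda>v::'b. (0::'a, v)) Basis"
    by (auto intro: inj_onI)
  then show ?thesis
    unfolding Basis_prod_def by (subst sum.union_disjoint) (auto simp: sum.reindex)
qed

lemma abs_inner_le_infnorm_l1:
  fixes u v :: "'a::euclidean_space"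
  shows "\<bar>u \<bullet> v\<bar> \<le> infnorm u * (\<Sum>b\<in>Basis. \<bar>v \<bullet> b\<bar>)"
proof -
  have "\<bar>u \<bullet> v\<bar> \<le> (\<Sum>b\<in>Basis. \<bar>u \<bullet> b\<bar> * \<bar>v \<bullet> b\<bar>)"
    unfolding euclidean_inner[of u v] by (metis (no_types, lifting) abs_mult sum_abs sum.cong)
  also have "\<dots> \<le> (\<Sum>b\<in>Basis. infnorm u * \<bar>v \<bullet> b\<bar>)"
    by (intro sum_mono mult_right_mono Basis_le_infnorm) auto
  finally show ?thesis by (simp add: sum_distrib_left)
qed

lemma abs_Max_diff_le:
  fixes f g :: "'a \<Rightarrow> real"
  assumes "finite I" "I \<noteq> {}" "\<And>i. i \<in> I \<Longrightarrow> \<bar>f i - g i\<bar> \<le> e"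
  shows "\<bar>(MAX i\<in>I. f i) - (MAX i\<in>I. g i)\<bar> \<le> e"
proof -
  have "(MAX i\<in>I. u i) \<le> (MAX i\<in>I. w i) + e"
    if "\<And>i. i \<in> I \<Longrightarrow> u i \<le> w i + e" for u w :: "'a \<Rightarrow> real"
  proof (rule Max.boundedI)
    fix y assume "y \<in> u ` I"
    then obtain i where "i \<in> I" "y = u i" by blast
    moreover have "w i \<le> (MAX i\<in>I. w i)" using assms(1) \<open>i \<in> I\<close> by simp
    ultimately show "y \<le> (MAX i\<in>I. w i) + e" using that[of i] by simp
  qed (use assms in auto)
  from this[of f g] this[of g f] show ?thesis
    using assms(3) by (fastforce simp: abs_le_iff)
qed

lemma pa_fun_diff_le:
  fixes t t' :: "'p::finite pa_params"
  assumes "K \<ge> 1" and close: "\<And>k. k \<in> {1..K} \<Longrightarrow> infnorm (t k - t' k) \<le> r"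
    and x: "infnorm x \<le> R"
  shows "\<bar>pa_fun K t x - pa_fun K t' x\<bar> \<le> 2 * (r * (real CARD('p) * R + 1))"
proof -
  \<comment> \<open>Both affine functions of a parameter are inner products with a vector whose sum norm is
    at most \<open>p * R + 1\<close>.\<close>
  define u v :: "(real ^ 'p) \<times> real \<times> (real ^ 'p) \<times> real"
    where "u = (x, 1, 0, 0)" and "v = (0, 0, x, 1)"
  have "(\<Sum>b\<in>Basis. \<bar>x \<bullet> b\<bar>) \<le> (\<Sum>b\<in>(Basis :: (real ^ 'p) set). R)"
    using x by (intro sum_mono) (auto simp: infnorm_le_iff)
  then have l1: "(\<Sum>b\<in>Basis. \<bar>u \<bullet> b\<bar>) \<le> real CARD('p) * R + 1"
      "(\<Sum>b\<in>Basis. \<bar>v \<bullet> b\<bar>) \<le> real CARD('p) * R + 1"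
    by (simp_all add: u_def v_def l1_Pair)
  have close': "\<bar>t k \<bullet> w - t' k \<bullet> w\<bar> \<le> r * (real CARD('p) * R + 1)"
    if "k \<in> {1..K}" "w = u \<or> w = v" for k w
  proof -
    have "\<bar>t k \<bullet> w - t' k \<bullet> w\<bar> \<le> infnorm (t k - t' k) * (\<Sum>b\<in>Basis. \<bar>w \<bullet> b\<bar>)"
      using abs_inner_le_infnorm_l1[of "t k - t' k" w] by (simp add: inner_diff_left)
    also have "\<dots> \<le> r * (real CARD('p) * R + 1)"
      using close[OF that(1)] l1 that(2) infnorm_pos_le[of "t k - t' k"]
      by (intro mult_mono) (auto intro: sum_nonneg)
    finally show ?thesis .
  qed
  have pa: "pa_fun K s x = (MAX k\<in>{1..K}. s k \<bullet> u) - (MAX k\<in>{1..K}. s k \<bullet> v)"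
    for s :: "'p pa_params"
  proof -
    have "(case s k of (\<alpha>, a, \<beta>, b) \<Rightarrow> \<alpha> \<bullet> x + a) = s k \<bullet> u"
      "(case s k of (\<alpha>, a, \<beta>, b) \<Rightarrow> \<beta> \<bullet> x + b) = s k \<bullet> v" for k
      by (simp_all add: u_def v_def split: prod.split)
    then show ?thesis by (simp add: pa_fun_def)
  qed
  have "\<bar>(MAX k\<in>{1..K}. t k \<bullet> w) - (MAX k\<in>{1..K}. t' k \<bullet> w)\<bar> \<le> r * (real CARD('p) * R + 1)"
    if "w = u \<or> w = v" for w
    using close' that \<open>K \<ge> 1\<close> by (intro abs_Max_diff_le) auto
  from this[of u] this[of v] show ?thesis unfolding pa by (simp add: abs_le_iff)
qed

lemma norm_pa_map_diff_le:
  fixes \<theta> \<theta>' :: "'d::finite \<Rightarrow> 'p::finite pa_params"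
  assumes "K \<ge> 1" and "\<And>\<iota> k. k \<in> {1..K} \<Longrightarrow> infnorm (\<theta> \<iota> k - \<theta>' \<iota> k) \<le> r"
    and "infnorm x \<le> R"
  shows "norm (pa_map K \<theta> x - pa_map K \<theta>' x)
    \<le> real CARD('d) * (2 * (r * (real CARD('p) * R + 1)))"
proof -
  have "norm (pa_map K \<theta> x - pa_map K \<theta>' x)
      \<le> (\<Sum>\<iota>\<in>UNIV. \<bar>pa_fun K (\<theta> \<iota>) x - pa_fun K (\<theta>' \<iota>) x\<bar>)"
    using norm_le_l1_cart[of "pa_map K \<theta> x - pa_map K \<theta>' x"] by (simp add: pa_map_def)
  also have "\<dots> \<le> (\<Sum>\<iota>\<in>(UNIV :: 'd set). 2 * (r * (real CARD('p) * R + 1)))"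
    using assms by (intro sum_mono pa_fun_diff_le) auto
  finally show ?thesis by simp
qed

lemma pa_map_borel_measurable: "pa_map K \<theta> \<in> borel_measurable borel"
proof -
  have "pa_fun K t \<in> borel_measurable borel" for t :: "'a pa_params"
    unfolding pa_fun_def case_prod_beta by measurable
  then show ?thesis
    by (subst borel_measurable_euclidean_space)
      (auto simp: pa_map_def Basis_vec_def inner_axis)
qed

lemma pa_map_cover:
  fixes \<mu> :: real and m K :: nat
  assumes "m \<ge> 1" "K \<ge> 1"
  shows "\<exists>\<Theta> :: ('d::finite \<Rightarrow> 'p::finite pa_params) set. finite \<Theta> \<and>
    card \<Theta> \<le> m ^ (2 * (CARD('p) + 1) * K * CARD('d)) \<and>
    (\<forall>\<theta>. (\<forall>\<iota>. params_infnorm K (\<theta> \<iota>) \<le> \<mu>) \<longrightarrow>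
      (\<exists>\<theta>'\<in>\<Theta>. \<forall>x R. infnorm x \<le> R \<longrightarrow>
        norm (pa_map K \<theta> x - pa_map K \<theta>' x)
          \<le> real CARD('d) * (2 * (\<mu> / m * (real CARD('p) * R + 1)))))"
proof -
  let ?D = "DIM((real ^ 'p) \<times> real \<times> (real ^ 'p) \<times> real)"
  obtain C :: "((real ^ 'p) \<times> real \<times> (real ^ 'p) \<times> real) set"
    where C: "finite C" "card C \<le> m ^ ?D"
      and cover: "\<And>x. infnorm x \<le> \<mu> \<Longrightarrow> \<exists>c\<in>C. infnorm (x - c) \<le> \<mu> / m"
    using infnorm_ball_cover[OF assms(1)] by blast
  define \<Theta> :: "('d \<Rightarrow> 'p pa_params) set" where "\<Theta> = (UNIV \<rightarrow>\<^sub>E ({1..K} \<rightarrow>\<^sub>E C))"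
  have "finite \<Theta>" unfolding \<Theta>_def by (intro finite_PiE) (use C in auto)
  have "card \<Theta> = card C ^ (K * CARD('d))"
    by (simp add: \<Theta>_def card_PiE power_mult)
  also have "\<dots> \<le> (m ^ ?D) ^ (K * CARD('d))" using C by (intro power_mono) auto
  also have "\<dots> = m ^ (2 * (CARD('p) + 1) * K * CARD('d))"
  proof -
    have "?D = 2 * (CARD('p) + 1)" by simp
    then show ?thesis by (simp only: power_mult[symmetric] mult.assoc)
  qed
  finally have "card \<Theta> \<le> m ^ (2 * (CARD('p) + 1) * K * CARD('d))" .
  moreover have "\<exists>\<theta>'\<in>\<Theta>. \<forall>x R. infnorm x \<le> R \<longrightarrow>
      norm (pa_map K \<theta> x - pa_map K \<theta>' x)
        \<le> real CARD('d) * (2 * (\<mu> / m * (real CARD('p) * R + 1)))"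
    if "\<forall>\<iota>. params_infnorm K (\<theta> \<iota>) \<le> \<mu>" for \<theta> :: "'d \<Rightarrow> 'p pa_params"
  proof -
    have "infnorm (\<theta> \<iota> k) \<le> \<mu>" if "k \<in> {1..K}" for \<iota> k
    proof -
      have "infnorm (\<theta> \<iota> k) \<le> params_infnorm K (\<theta> \<iota>)"
        unfolding params_infnorm_def using that by (intro Max_ge) auto
      then show ?thesis using \<open>\<forall>\<iota>. params_infnorm K (\<theta> \<iota>) \<le> \<mu>\<close> order_trans by blast
    qed
    then have "\<forall>\<iota> k. \<exists>c. k \<in> {1..K} \<longrightarrow> c \<in> C \<and> infnorm (\<theta> \<iota> k - c) \<le> \<mu> / m"
      using cover by blast
    then obtain c where c: "\<And>\<iota> k. k \<in> {1..K} \<Longrightarrow>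
        c \<iota> k \<in> C \<and> infnorm (\<theta> \<iota> k - c \<iota> k) \<le> \<mu> / m"
      by metis
    have "(\<lambda>\<iota>. restrict (c \<iota>) {1..K}) \<in> \<Theta>" using c by (auto simp: \<Theta>_def)
    then show ?thesis using c
      by (intro bexI[of _ "\<lambda>\<iota>. restrict (c \<iota>) {1..K}"] allI impI
          norm_pa_map_diff_le[OF assms(2)]) auto
  qed
  ultimately show ?thesis using \<open>finite \<Theta>\<close> by blast
qed

section \<open>Probability\<close>

text \<open>The complement of the support is the union of all null open sets, and countably many
  null sets of a countable base suffice to form it.\<close>

lemma AE_measure_support:
  fixes D :: "'a::second_countable_topology measure"
  assumes [measurable_cong]: "sets D = sets borel"
  shows "AE x in D. x \<in> measure_support D"
proof -
  obtain B :: "'a set set" where B: "countable B" "topological_basis B"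
    using ex_countable_basis by blast
  define B0 where "B0 = {U \<in> B. emeasure D U = 0}"
  have "U \<in> null_sets D" if "U \<in> B0" for U
    using that topological_basis_open[OF B(2)] assms by (auto simp: B0_def)
  then have "AE x in D. \<forall>U\<in>B0. x \<notin> U"
    using B(1) by (subst AE_ball_countable) (auto simp: B0_def intro: AE_not_in)
  then show ?thesis
  proof (rule AE_mp, intro AE_I2 impI)
    fix x assume out: "\<forall>U\<in>B0. x \<notin> U"
    have "emeasure D U > 0" if U: "open U" "x \<in> U" for U
    proof -
      obtain V where V: "V \<in> B" "x \<in> V" "V \<subseteq> U"
        using topological_basisE[OF B(2) U] by blast
      then have "emeasure D V \<noteq> 0" using out by (auto simp: B0_def)
      moreover have "emeasure D V \<le> emeasure D U"
        using V U assms by (intro emeasure_mono) auto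
      ultimately show ?thesis by (metis not_gr_zero le_zero_eq)
    qed
    then show "x \<in> measure_support D" by (simp add: measure_support_def)
  qed
qed

text \<open>A set of probability \<open>q > \<eta>\<close> is missed by \<open>n\<close> independent points with probability
  \<open>(1 - q) ^ n \<le> exp (- n * \<eta>)\<close>; the rest is the union bound.\<close>

lemma (in prob_space) sample_hits_heavy_sets:
  fixes \<A> :: "'a set set" and I :: "'i set" and \<eta> \<delta> :: real
  assumes I: "finite I" and \<A>: "finite \<A>" "\<A> \<subseteq> events"
    and card: "real (card \<A>) * exp (- real (card I) * \<eta>) \<le> \<delta>"
  shows "\<exists>E \<in> sets (\<Pi>\<^sub>M s\<in>I. M). measure (\<Pi>\<^sub>M s\<in>I. M) E \<ge> 1 - \<delta> \<and>
    (\<forall>\<Xi>\<in>E. \<forall>A\<in>\<A>. prob A > \<eta> \<longrightarrow> (\<exists>s\<in>I. \<Xi> s \<in> A))"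
proof -
  interpret P: finite_product_prob_space "\<lambda>_. M" I
    by unfold_locales (fact I)
  define miss where "miss A = (\<Pi>\<^sub>E s\<in>I. space M - A)" for A
  define H where "H = {A \<in> \<A>. prob A > \<eta>}"
  have H: "finite H" "H \<subseteq> \<A>" using \<A> by (auto simp: H_def)
  have miss_sets: "miss A \<in> sets (\<Pi>\<^sub>M s\<in>I. M)" if "A \<in> H" for A
    unfolding miss_def using I that H \<A> by (intro sets_PiM_I_finite) auto
  have miss_prob: "P.prob (miss A) \<le> exp (- real (card I) * \<eta>)" if "A \<in> H" for A
  proof -
    have A: "A \<in> events" "prob A > \<eta>" using that \<A> by (auto simp: H_def)
    have "P.prob (miss A) = prob (space M - A) ^ card I"
      unfolding miss_def using A by (subst P.prob_times) auto
    also have "\<dots> = (1 - prob A) ^ card I" using A by (simp add: prob_compl)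
    also have "\<dots> \<le> exp (- \<eta>) ^ card I"
    proof (intro power_mono)
      have "1 + - prob A \<le> exp (- prob A)" by (rule exp_ge_add_one_self)
      also have "\<dots> \<le> exp (- \<eta>)" using A by simp
      finally show "1 - prob A \<le> exp (- \<eta>)" by simp
    qed simp
    finally show ?thesis by (simp add: exp_of_nat_mult[symmetric])
  qed
  define E where "E = space (\<Pi>\<^sub>M s\<in>I. M) - (\<Union>A\<in>H. miss A)"
  have U: "(\<Union>A\<in>H. miss A) \<in> sets (\<Pi>\<^sub>M s\<in>I. M)" using H miss_sets by auto
  have "P.prob (\<Union>A\<in>H. miss A) \<le> (\<Sum>A\<in>H. P.prob (miss A))"
    using H miss_sets by (intro measure_UNION_le) auto
  also have "\<dots> \<le> (\<Sum>A\<in>H. exp (- real (card I) * \<eta>))"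
    by (intro sum_mono miss_prob)
  also have "\<dots> \<le> real (card \<A>) * exp (- real (card I) * \<eta>)"
    using card_mono[OF \<A>(1) H(2)] by (simp add: mult_right_mono)
  finally have "P.prob E \<ge> 1 - \<delta>"
    unfolding E_def using card U by (subst P.prob_compl) auto
  moreover have "E \<in> sets (\<Pi>\<^sub>M s\<in>I. M)" unfolding E_def using U by auto
  moreover have "\<exists>s\<in>I. \<Xi> s \<in> A" if "\<Xi> \<in> E" "A \<in> \<A>" "prob A > \<eta>" for \<Xi> A
    using that by (auto simp: E_def H_def miss_def space_PiM PiE_iff)
  ultimately show ?thesis by blast
qed

section \<open>Constraint violation of feasible maps\<close>

text \<open>The bound for any grid whose resolution \<open>m\<close> moves the constraints by at most half of the
  margin.\<close>

lemma feasible_violation_bound: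
  fixes M :: "'w measure" and N :: "'y measure"
    and X :: "'w \<Rightarrow> real ^ 'p::finite" and Y :: "'w \<Rightarrow> 'y"
    and \<psi> :: "nat \<Rightarrow> real ^ 'd::finite \<Rightarrow> real"
    and K J n m :: nat and \<mu> \<gamma> R L \<delta> \<eta> :: real
  assumes M: "prob_space M" and X: "X \<in> borel_measurable M" and Y: "Y \<in> measurable M N"
    and supp: "compact (measure_support (distr M borel X))"
    and R: "\<And>x. x \<in> measure_support (distr M borel X) \<Longrightarrow> infnorm x \<le> R"
    and K: "K \<ge> 1" and J: "J \<ge> 1" and m: "m \<ge> 1"
    and lip: "\<And>j. j \<in> {1..J} \<Longrightarrow> L-lipschitz_on UNIV (\<psi> j)"
    and fine: "\<mu> \<ge> 0 \<Longrightarrow>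
      L * (real CARD('d) * (2 * (\<mu> / m * (real CARD('p) * R + 1)))) \<le> \<gamma> / 2"
    and \<eta>: "real (m ^ (2 * (CARD('p) + 1) * K * CARD('d))) * exp (- real n * \<eta>) \<le> \<delta>"
  shows "\<exists>E \<in> sets (iid_sample n M N X Y). measure (iid_sample n M N X Y) E \<ge> 1 - \<delta> \<and>
    (\<forall>\<Xi>\<in>E. \<forall>f\<in>feasible_class K \<mu> \<gamma> J \<psi> n \<Xi>.
      \<P>(\<omega> in M. (MAX j\<in>{1..J}. \<psi> j (f (X \<omega>))) > 0) \<le> \<eta>)"
proof -
  interpret M: prob_space M by (fact M)
  define S where "S = measure_support (distr M borel X)"
  define D where "D = distr M (borel \<Otimes>\<^sub>M N) (\<lambda>\<omega>. (X \<omega>, Y \<omega>))"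
  have XY: "(\<lambda>\<omega>. (X \<omega>, Y \<omega>)) \<in> M \<rightarrow>\<^sub>M borel \<Otimes>\<^sub>M N" using X Y by measurable
  interpret D: prob_space D unfolding D_def by (rule M.prob_space_distr[OF XY])
  obtain \<Theta> :: "('d \<Rightarrow> 'p pa_params) set" where \<Theta>: "finite \<Theta>"
      "card \<Theta> \<le> m ^ (2 * (CARD('p) + 1) * K * CARD('d))"
    and cover: "\<And>\<theta>. (\<forall>\<iota>. params_infnorm K (\<theta> \<iota>) \<le> \<mu>) \<Longrightarrow>
      \<exists>\<theta>'\<in>\<Theta>. \<forall>x R. infnorm x \<le> R \<longrightarrow> norm (pa_map K \<theta> x - pa_map K \<theta>' x)
          \<le> real CARD('d) * (2 * (\<mu> / m * (real CARD('p) * R + 1)))"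
    using pa_map_cover[OF m K] by metis
  \<comment> \<open>Restricting to the support makes the sample avoid these sets also when some of its points
    lie outside of the support, where nothing is known about the maps.\<close>
  define A where "A \<theta> = S \<inter> {x. \<exists>j\<in>{1..J}. \<psi> j (pa_map K \<theta> x) > - \<gamma> / 2}"
    for \<theta> :: "'d \<Rightarrow> 'p pa_params"
  have A_sets: "A \<theta> \<in> sets borel" for \<theta>
  proof -
    have [measurable]: "(\<lambda>x. \<psi> j (pa_map K \<theta> x)) \<in> borel_measurable borel"
      if "j \<in> {1..J}" for j
      using measurable_compose[OF pa_map_borel_measurable]
        borel_measurable_continuous_onI[OF lipschitz_on_continuous_on[OF lip[OF that]]] by blast
    have "S \<in> sets borel" using supp by (simp add: S_def borel_compact)
    moreover have "{x. \<exists>j\<in>{1..J}. \<psi> j (pa_map K \<theta> x) > - \<gamma> / 2}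
        = (\<Union>j\<in>{1..J}. {x \<in> space borel. \<psi> j (pa_map K \<theta> x) > - \<gamma> / 2})" by auto
    moreover have "\<dots> \<in> sets borel" by (intro sets.finite_UN) auto
    ultimately show ?thesis by (simp add: A_def sets.Int)
  qed
  define \<A> where "\<A> = (\<lambda>\<theta>. A \<theta> \<times> space N) ` \<Theta>"
  have "real (card \<A>) \<le> real (m ^ (2 * (CARD('p) + 1) * K * CARD('d)))"
    unfolding \<A>_def of_nat_le_iff using card_image_le[OF \<Theta>(1)] \<Theta>(2) le_trans by blast
  then have "real (card \<A>) * exp (- real n * \<eta>)
      \<le> real (m ^ (2 * (CARD('p) + 1) * K * CARD('d))) * exp (- real n * \<eta>)"
    by (intro mult_right_mono exp_ge_zero)
  then have "real (card \<A>) * exp (- real (card {1..n}) * \<eta>) \<le> \<delta>"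
    using order_trans[OF _ \<eta>] by simp
  moreover have "finite \<A>" "\<A> \<subseteq> D.events"
    using \<Theta> A_sets by (auto simp: \<A>_def D_def)
  ultimately obtain E where E: "E \<in> sets (\<Pi>\<^sub>M s\<in>{1..n}. D)"
      "measure (\<Pi>\<^sub>M s\<in>{1..n}. D) E \<ge> 1 - \<delta>"
    and hit: "\<And>\<Xi> B. \<Xi> \<in> E \<Longrightarrow> B \<in> \<A> \<Longrightarrow> D.prob B > \<eta> \<Longrightarrow> \<exists>s\<in>{1..n}. \<Xi> s \<in> B"
    using D.sample_hits_heavy_sets[of "{1..n}" \<A> \<eta> \<delta>] by blast
  have "\<P>(\<omega> in M. (MAX j\<in>{1..J}. \<psi> j (f (X \<omega>))) > 0) \<le> \<eta>"
    if "\<Xi> \<in> E" and f: "f \<in> feasible_class K \<mu> \<gamma> J \<psi> n \<Xi>" for \<Xi> f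
  proof -
    obtain \<theta> where \<theta>: "\<forall>\<iota>. params_infnorm K (\<theta> \<iota>) \<le> \<mu>" and f_eq: "f = pa_map K \<theta>"
      using f by (auto simp: feasible_class_def pa_class_def pa_map_def[abs_def])
    have "\<mu> \<ge> 0" using \<theta> params_infnorm_nonneg[OF K] order_trans by blast
    obtain \<theta>' where \<theta>': "\<theta>' \<in> \<Theta>" and near: "\<And>x R. infnorm x \<le> R \<Longrightarrow>
        norm (f x - pa_map K \<theta>' x)
          \<le> real CARD('d) * (2 * (\<mu> / m * (real CARD('p) * R + 1)))"
      using cover[OF \<theta>] f_eq by blast
    have half: "\<bar>\<psi> j (f x) - \<psi> j (pa_map K \<theta>' x)\<bar> \<le> \<gamma> / 2" if "x \<in> S" "j \<in> {1..J}" for x j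
    proof -
      have "\<bar>\<psi> j (f x) - \<psi> j (pa_map K \<theta>' x)\<bar> \<le> L * norm (f x - pa_map K \<theta>' x)"
        using lipschitz_onD[OF lip[OF that(2)], of "f x" "pa_map K \<theta>' x"]
        by (simp add: dist_norm)
      also have "\<dots> \<le> L * (real CARD('d) * (2 * (\<mu> / m * (real CARD('p) * R + 1))))"
        using near[OF R] that lipschitz_on_nonneg[OF lip[OF that(2)]]
        by (intro mult_left_mono) (auto simp: S_def)
      finally show ?thesis using fine[OF \<open>\<mu> \<ge> 0\<close>] by simp
    qed
    have "\<Xi> s \<notin> A \<theta>' \<times> space N" if s: "s \<in> {1..n}" for s
    proof
      assume "\<Xi> s \<in> A \<theta>' \<times> space N"
      then obtain j where j: "fst (\<Xi> s) \<in> S" "j \<in> {1..J}"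
          "\<psi> j (pa_map K \<theta>' (fst (\<Xi> s))) > - \<gamma> / 2"
        by (auto simp: A_def)
      moreover have "\<psi> j (f (fst (\<Xi> s))) + \<gamma> \<le> 0"
        using f s j by (auto simp: feasible_class_def)
      ultimately show False using half[of "fst (\<Xi> s)" j] by linarith
    qed
    then have "D.prob (A \<theta>' \<times> space N) \<le> \<eta>"
      using hit[OF \<open>\<Xi> \<in> E\<close>, of "A \<theta>' \<times> space N"] \<theta>' by (force simp: \<A>_def)
    also have "D.prob (A \<theta>' \<times> space N) = \<P>(\<omega> in M. X \<omega> \<in> A \<theta>')"
    proof -
      have "(\<lambda>\<omega>. (X \<omega>, Y \<omega>)) -` (A \<theta>' \<times> space N) \<inter> space M = {\<omega> \<in> space M. X \<omega> \<in> A \<theta>'}"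
        using measurable_space[OF Y] by auto
      then show ?thesis unfolding D_def using XY A_sets by (subst measure_distr) auto
    qed
    finally have "\<P>(\<omega> in M. X \<omega> \<in> A \<theta>') \<le> \<eta>" .
    moreover have "\<P>(\<omega> in M. (MAX j\<in>{1..J}. \<psi> j (f (X \<omega>))) > 0) \<le> \<P>(\<omega> in M. X \<omega> \<in> A \<theta>')"
    proof (rule M.finite_measure_mono_AE)
      have "AE \<omega> in M. X \<omega> \<in> S"
        using AE_distrD[OF X AE_measure_support[of "distr M borel X"]] by (simp add: S_def)
      then show "AE \<omega> in M. \<omega> \<in> {\<omega> \<in> space M. (MAX j\<in>{1..J}. \<psi> j (f (X \<omega>))) > 0} \<longrightarrow>
          \<omega> \<in> {\<omega> \<in> space M. X \<omega> \<in> A \<theta>'}"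
      proof (rule AE_mp, intro AE_I2 impI)
        fix \<omega> assume \<omega>: "X \<omega> \<in> S" "\<omega> \<in> {\<omega> \<in> space M. (MAX j\<in>{1..J}. \<psi> j (f (X \<omega>))) > 0}"
        then obtain j where j: "j \<in> {1..J}" "\<psi> j (f (X \<omega>)) > 0"
          using J by (auto simp: Max_gr_iff)
        then have "\<psi> j (pa_map K \<theta>' (X \<omega>)) > - \<gamma> / 2"
          using half[of "X \<omega>" j] \<omega> by linarith
        then show "\<omega> \<in> {\<omega> \<in> space M. X \<omega> \<in> A \<theta>'}" using \<omega> j by (auto simp: A_def)
      qed
      show "{\<omega> \<in> space M. X \<omega> \<in> A \<theta>'} \<in> sets M"
        using measurable_sets[OF X A_sets, of \<theta>'] by (simp add: vimage_def Int_def conj_commute)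
    qed
    ultimately show ?thesis by simp
  qed
  then show ?thesis using E unfolding iid_sample_def D_def[symmetric] by blast
qed

text \<open>The sum norm \<open>p * R + 1\<close> of the vector that multiplies the parameters is turned by the
  Cauchy--Schwarz inequality into the product of the two square roots, of which
  \<open>sqrt (p + 1)\<close> is then bounded by \<open>p + 1\<close>. The second lower bound on \<open>m\<close> is \<open>0\<close> in the
  degenerate cases \<open>d = 0\<close>, \<open>L = 0\<close> and \<open>\<mu> = 0\<close>, in which one grid point per coordinate is
  enough.\<close>

lemma grid_fine_enough:
  fixes d p L \<gamma> \<mu> R K m :: real
  assumes "d \<ge> 0" "p \<ge> 0" "L \<ge> 0" "\<gamma> > 0" "\<mu> \<ge> 0" "K \<ge> 1" "m \<ge> 1"
    and m: "m \<ge> 8 * L / \<gamma> * sqrt (2 * K * (p * R\<^sup>2 + 1)) * (d * (p + 1) * \<mu>)"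
  shows "L * (d * (2 * (\<mu> / m * (p * R + 1)))) \<le> \<gamma> / 2"
proof -
  have "0 \<le> p * (R - 1)\<^sup>2" using assms by simp
  then have "(p * R + 1)\<^sup>2 \<le> (p + 1) * (p * R\<^sup>2 + 1)"
    by (simp add: power2_eq_square algebra_simps)
  also have "\<dots> \<le> (p + 1)\<^sup>2 * (2 * K * (p * R\<^sup>2 + 1))"
  proof (intro mult_mono)
    show "p + 1 \<le> (p + 1)\<^sup>2" using assms by (simp add: power2_eq_square algebra_simps)
    show "p * R\<^sup>2 + 1 \<le> 2 * K * (p * R\<^sup>2 + 1)"
      using assms mult_right_mono[of 1 "2 * K" "p * R\<^sup>2 + 1"] by simp
  qed (use assms in auto)
  finally have "p * R + 1 \<le> sqrt ((p + 1)\<^sup>2 * (2 * K * (p * R\<^sup>2 + 1)))"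
    by (rule real_le_rsqrt)
  then have "p * R + 1 \<le> (p + 1) * sqrt (2 * K * (p * R\<^sup>2 + 1))"
    using assms by (simp add: real_sqrt_mult[of "(p + 1)\<^sup>2"])
  then have "8 * (L * d * \<mu>) * (p * R + 1)
      \<le> 8 * (L * d * \<mu>) * ((p + 1) * sqrt (2 * K * (p * R\<^sup>2 + 1)))"
    using assms by (intro mult_left_mono) auto
  also have "\<dots> \<le> \<gamma> * m"
    using mult_left_mono[OF m, of \<gamma>] \<open>\<gamma> > 0\<close> by (simp add: ac_simps)
  finally have "8 * (L * d * \<mu> * (p * R + 1)) \<le> \<gamma> * m" by (simp add: algebra_simps)
  moreover have "0 \<le> \<gamma> * m" using assms by simp
  ultimately have "4 * (L * d * \<mu> * (p * R + 1)) \<le> \<gamma> * m" by linarith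
  then show ?thesis using assms by (simp add: field_simps)
qed

text \<open>A probability bounded by \<open>u + v\<close> is bounded by \<open>min 1 u + min 1 v\<close>, and
  \<open>min 1 u \<le> sqrt u\<close>.\<close>

lemma le_one_imp_le_sqrt_add_sqrt:
  fixes q u v :: real
  assumes "q \<le> 1" "q \<le> u + v" "u \<ge> 0" "v \<ge> 0"
  shows "q \<le> sqrt u + sqrt v"
proof -
  have "min 1 w \<le> sqrt w" if "w \<ge> 0" for w :: real
  proof (rule real_le_rsqrt)
    show "(min 1 w)\<^sup>2 \<le> w"
      using that mult_left_mono[of w 1 w] by (auto simp: min_def power2_eq_square)
  qed
  from this[of u] this[of v] have "min 1 u + min 1 v \<le> sqrt u + sqrt v"
    using assms by simp
  moreover have "q \<le> min 1 u + min 1 v" using assms by (simp add: min_def)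
  ultimately show ?thesis by simp
qed

theorem proposition12:
  fixes M :: "'w measure" and N :: "'y measure"
    and X :: "'w \<Rightarrow> real ^ 'p" and Y :: "'w \<Rightarrow> 'y"
    and \<X> :: "(real ^ 'p) set"
    and \<phi> :: "real ^ 'd \<Rightarrow> 'y \<Rightarrow> real"
    and \<psi> :: "nat \<Rightarrow> real ^ 'd \<Rightarrow> real"
    and K J n :: nat
    and \<mu> \<gamma> Xbar L\<psi> \<delta> :: real
  assumes "prob_space M"
    and "X \<in> borel_measurable M"
    and "Y \<in> measurable M N"
    and "\<X> = measure_support (distr M borel X)"
    and "compact \<X>"
    and "\<exists>x\<in>\<X>. infnorm x = Xbar" and "\<forall>x\<in>\<X>. infnorm x \<le> Xbar"
    and "K \<ge> 1" and "J \<ge> 1" and "n \<ge> 1"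
    and "\<gamma> > 0" and "0 < \<delta>" and "\<delta> \<le> 1"
    and "\<forall>j\<in>{1..J}. L\<psi>-lipschitz_on UNIV (\<psi> j)"
  shows "\<exists>E \<in> sets (iid_sample n M N X Y).
    measure (iid_sample n M N X Y) E \<ge> 1 - \<delta> \<and>
    (\<forall>\<Xi>\<in>E. \<forall>f. optimal_solution \<phi> n \<Xi> (feasible_class K \<mu> \<gamma> J \<psi> n \<Xi>) f \<longrightarrow>
       \<P>(\<omega> in M. (MAX j\<in>{1..J}. \<psi> j (f (X \<omega>))) > 0) <
         sqrt (4 * real CARD('d) * real K * (real CARD('p) + 1) / real n *
               ln (real_of_int \<lceil>8 * L\<psi> / \<gamma> * sqrt (2 * real K * (real CARD('p) * Xbar\<^sup>2 + 1)) *
                     (real CARD('d) * (real CARD('p) + 1) * \<mu>)\<rceil>)) +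
         sqrt (ln (2 * real n) / real n) +
         sqrt (2 * ln (1 / \<delta>) / real n))"
proof -
  define B where "B = 8 * L\<psi> / \<gamma> * sqrt (2 * real K * (real CARD('p) * Xbar\<^sup>2 + 1)) *
    (real CARD('d) * (real CARD('p) + 1) * \<mu>)"
  define m where "m = max 1 (nat \<lceil>B\<rceil>)"
  define e where "e = 2 * (CARD('p) + 1) * K * CARD('d)"
  define \<eta> where "\<eta> = real e * ln (real m) / real n + ln (1 / \<delta>) / real n"
  have m: "m \<ge> 1" "real m \<ge> B"
    unfolding m_def by (auto intro: order_trans[OF real_nat_ceiling_ge])
  have "L\<psi> \<ge> 0" using assms(9,14) lipschitz_on_nonneg by fastforce
  have "\<exists>E \<in> sets (iid_sample n M N X Y). measure (iid_sample n M N X Y) E \<ge> 1 - \<delta> \<and>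
    (\<forall>\<Xi>\<in>E. \<forall>f\<in>feasible_class K \<mu> \<gamma> J \<psi> n \<Xi>.
      \<P>(\<omega> in M. (MAX j\<in>{1..J}. \<psi> j (f (X \<omega>))) > 0) \<le> \<eta>)"
  proof (rule feasible_violation_bound[where R = Xbar and L = L\<psi> and m = m])
    show "L\<psi> * (real CARD('d) * (2 * (\<mu> / m * (real CARD('p) * Xbar + 1)))) \<le> \<gamma> / 2"
      if "\<mu> \<ge> 0"
      using that m \<open>L\<psi> \<ge> 0\<close> assms(8,11) unfolding B_def
      by (intro grid_fine_enough[where K = "real K"]) auto
    have "real (m ^ e) * exp (- real n * \<eta>) = \<delta>"
    proof -
      have "real n * \<eta> = real e * ln (real m) - ln \<delta>"
        using assms(10,12) by (simp add: \<eta>_def ln_div field_simps)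
      then have "exp (- real n * \<eta>) = \<delta> / real m ^ e"
        using m assms(12) by (simp add: exp_diff exp_of_nat_mult)
      then show ?thesis using m by simp
    qed
    then show "real (m ^ (2 * (CARD('p) + 1) * K * CARD('d))) * exp (- real n * \<eta>) \<le> \<delta>"
      by (simp add: e_def)
  qed (use assms m in auto)
  then obtain E where E: "E \<in> sets (iid_sample n M N X Y)"
      "measure (iid_sample n M N X Y) E \<ge> 1 - \<delta>"
    and violation: "\<And>\<Xi> f. \<Xi> \<in> E \<Longrightarrow> f \<in> feasible_class K \<mu> \<gamma> J \<psi> n \<Xi> \<Longrightarrow>
      \<P>(\<omega> in M. (MAX j\<in>{1..J}. \<psi> j (f (X \<omega>))) > 0) \<le> \<eta>"
    by blast
  have "\<P>(\<omega> in M. (MAX j\<in>{1..J}. \<psi> j (f (X \<omega>))) > 0) <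
      sqrt (4 * real CARD('d) * real K * (real CARD('p) + 1) / real n * ln (real_of_int \<lceil>B\<rceil>)) +
      sqrt (ln (2 * real n) / real n) + sqrt (2 * ln (1 / \<delta>) / real n)"
    if "\<Xi> \<in> E" "f \<in> feasible_class K \<mu> \<gamma> J \<psi> n \<Xi>" for \<Xi> f
  proof -
    have "\<mu> \<ge> 0"
      using that(2) by (auto simp: feasible_class_def pa_class_def
          intro: order_trans[OF params_infnorm_nonneg[OF assms(8)]])
    have "B \<ge> 0" unfolding B_def using \<open>\<mu> \<ge> 0\<close> \<open>L\<psi> \<ge> 0\<close> assms(11) by simp
    \<comment> \<open>Replacing the ceiling \<open>0\<close> by \<open>1\<close> does not change the logarithm, as \<open>ln 0 = 0\<close>.\<close>
    have ln_m: "ln (real_of_int \<lceil>B\<rceil>) = ln (real m)"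
    proof (cases "\<lceil>B\<rceil> = 0")
      case True
      then show ?thesis by (simp add: m_def)
    next
      case False
      then have "\<lceil>B\<rceil> \<ge> 1" using \<open>B \<ge> 0\<close> by linarith
      then have "int m = \<lceil>B\<rceil>" unfolding m_def by linarith
      then show ?thesis by (metis of_int_of_nat_eq)
    qed
    define u v where "u = real e * ln (real m) / real n" and "v = ln (1 / \<delta>) / real n"
    have nonneg: "u \<ge> 0" "v \<ge> 0" using m assms(12,13) by (auto simp: u_def v_def)
    have "\<P>(\<omega> in M. (MAX j\<in>{1..J}. \<psi> j (f (X \<omega>))) > 0) \<le> sqrt u + sqrt v"
      using violation[OF that(1,2)] prob_space.prob_le_1[OF assms(1)] nonneg
      by (intro le_one_imp_le_sqrt_add_sqrt) (auto simp: \<eta>_def u_def v_def)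
    also have "\<dots> \<le> sqrt (2 * u) + sqrt (2 * v)"
      using nonneg by (intro add_mono real_sqrt_le_mono) auto
    also have "\<dots> < sqrt (2 * u) + sqrt (ln (2 * real n) / real n) + sqrt (2 * v)"
      using assms(10) by simp
    also have "2 * u = 4 * real CARD('d) * real K * (real CARD('p) + 1) / real n *
        ln (real_of_int \<lceil>B\<rceil>)"
    proof -
      have "real e = 2 * (real CARD('p) + 1) * real K * real CARD('d)"
        by (simp add: e_def algebra_simps)
      then show ?thesis unfolding u_def ln_m by simp
    qed
    also have "2 * v = 2 * ln (1 / \<delta>) / real n" by (simp add: v_def)
    finally show ?thesis .
  qed
  then show ?thesis
    using E unfolding B_def optimal_solution_def is_arg_min_def by blast
qed

end
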